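(* Let $X,Y$ be real Hilbert spaces such that $Y$ is of dimension at least two. Let $v\colon X\to Y$ be a map. The following conditions are equivalent: (i) for any $A\subset X$ and for any $1$-Lipschitz map $u\colon A\to Y$ there exists a $1$-Lipschitz extension $\tilde{u}\colon X\to Y$ of $u$ such that for all $x\in X$ $$v(x)-\tilde{u}(x)\in\overline{\mathrm{Conv}}\big\{v(z)-u(z)\mid z\in A\big\};$$ (ii) for any $\delta>0$, any $A\subset X$ and for any $1$-Lipschitz map $u\colon A\to Y$ such that $\lVert v(x)-u(x)\rVert\leq \delta$ for all $x\in A$, there exists a $1$-Lipschitz extension $\tilde{u}\colon X\to Y$ of $u$ such that $\lVert v(x)-\tilde{u}(x)\rVert\leq \delta$ for all $x\in X$; (iii) $v$ is affine and $1$-Lipschitz.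
   Context: A map $f$ from a subset $S$ of a normed space to a normed space is $1$-Lipschitz if $\lVert f(x)-f(y)\rVert\leq\lVert x-y\rVert$ for all $x,y\in S$. A map $\tilde{u}\colon X\to Y$ is an extension of $u\colon A\to Y$ if $\tilde{u}(x)=u(x)$ for all $x\in A$. $\overline{\mathrm{Conv}}$ denotes the closed convex hull (norm closure of the convex hull). A map $v$ between real vector spaces is affine if $v(tx+(1-t)y)=tv(x)+(1-t)v(y)$ for all $x,y$ and all $t\in\mathbb{R}$.
   Formalization: In condition (i) the set A is required to be nonempty; for empty A the closed convex hull is empty, so (i) as written would fail for every v while (iii) holds, for example, for v = 0. *)

theory Defs
  imports "HOL-Analysis.Analysis"
begin

(* A real Hilbert space is a type of sort {real_inner, complete_space}.

   A partial map u : A -> Y is a total function of which only the values on A are used. *)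

(* The library constant dim is 0 on infinite-dimensional spaces, so a lower bound on the
   dimension is expressed by the existence of an independent set; card B = 2 forces B
   to be finite. *)
definition dim_at_least_two :: "'b::real_vector itself \<Rightarrow> bool" where
  "dim_at_least_two _ \<longleftrightarrow> (\<exists>B :: 'b set. independent B \<and> card B = 2)"

definition affine_map :: "('a::real_vector \<Rightarrow> 'b::real_vector) \<Rightarrow> bool" where
  "affine_map v \<longleftrightarrow>
     (\<forall>x y. \<forall>t::real. v (t *\<^sub>R x + (1 - t) *\<^sub>R y) = t *\<^sub>R v x + (1 - t) *\<^sub>R v y)"

definition closed_convex_hull :: "'b::real_normed_vector set \<Rightarrow> 'b set" where
  "closed_convex_hull S = closure (convex hull S)"

definition is_lipschitz_extension ::
    "'a::real_normed_vector set \<Rightarrow> ('a \<Rightarrow> 'b::real_normed_vector) \<Rightarrow> ('a \<Rightarrow> 'b) \<Rightarrow> bool" where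
  "is_lipschitz_extension A u u' \<longleftrightarrow> 1-lipschitz_on UNIV u' \<and> (\<forall>x\<in>A. u' x = u x)"

(* The set A is required to be nonempty here: for A = {} the closed convex hull is empty
   and the condition would fail for every v. *)
definition hull_extension_property ::
    "('a::real_normed_vector \<Rightarrow> 'b::real_normed_vector) \<Rightarrow> bool" where
  "hull_extension_property v \<longleftrightarrow>
     (\<forall>A u. A \<noteq> {} \<and> 1-lipschitz_on A u \<longrightarrow>
        (\<exists>u'. is_lipschitz_extension A u u' \<and>
              (\<forall>x. v x - u' x \<in> closed_convex_hull {v z - u z | z. z \<in> A})))"

definition uniform_extension_property ::
    "('a::real_normed_vector \<Rightarrow> 'b::real_normed_vector) \<Rightarrow> bool" where
  "uniform_extension_property v \<longleftrightarrow>
     (\<forall>\<delta>>0. \<forall>A u. 1-lipschitz_on A u \<and> (\<forall>x\<in>A. norm (v x - u x) \<le> \<delta>) \<longrightarrow>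
        (\<exists>u'. is_lipschitz_extension A u u' \<and> (\<forall>x. norm (v x - u' x) \<le> \<delta>)))"

end

theory Submission
  imports Defs
begin

text \<open>The conditions are proved in a cycle: (iii) gives (i), (i) gives (ii), and (ii) gives
  (iii).

  From (iii) to (i), Zorn's lemma reduces the task to adding one point x. With K the closed convex
  hull of the values v a - u a, the new value y must satisfy v x - y in K and lie in the ball of
  radius |x - a| about each u a. These sets are closed, convex and bounded, so weak compactness
  (\<open>closed_convex_finite_intersection_property\<close>) leaves finitely many constraints.
  There a minimax argument (\<open>one_point_extension_finite\<close>) asks only for a separate y
  for each convex average of constraints. For an average with centres a and b, y = v x - v a + b
  serves: v affine puts v a - b in K, and v 1-Lipschitz gives |y - b| \<le> |x - a|.

  From (i) to (ii), closed balls are closed and convex.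

  From (ii) to (iii), the empty domain shows that v is a uniform limit of 1-Lipschitz maps. If v has
  a defect on a segment, u is prescribed at the endpoints only, with their distance preserved
  exactly; then any 1-Lipschitz extension is affine on the segment
  (\<open>between_point_unique\<close>). A large shift against the defect, with a correction
  orthogonal to it (hence dimension two), makes the deviation inside the segment exceed that at the
  endpoints.\<close>

lemma lipschitz_on_1_iff:
  "1-lipschitz_on A u \<longleftrightarrow> (\<forall>x\<in>A. \<forall>y\<in>A. norm (u x - u y) \<le> norm (x - y))"
  by (simp add: lipschitz_on_def dist_norm)

lemma affine_mapD:
  assumes "affine_map v" and "s + t = 1"
  shows "v (s *\<^sub>R x + t *\<^sub>R y) = s *\<^sub>R v x + t *\<^sub>R v y"
proof -
  have "t = 1 - s" using assms(2) by simp
  then show ?thesis using assms(1) unfolding affine_map_def by blast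
qed

section \<open>Nearest points and weak compactness in Hilbert spaces\<close>

lemma Cauchy_dist_squared:
  fixes y :: "nat \<Rightarrow> 'a::metric_space"
  assumes "e \<longlonglongrightarrow> 0" and "\<And>n m. n \<le> m \<Longrightarrow> (dist (y n) (y m))\<^sup>2 \<le> e n"
  shows "Cauchy y"
  unfolding Cauchy_altdef2
proof (intro allI impI)
  fix \<epsilon> :: real assume "0 < \<epsilon>"
  then have "0 < \<epsilon>\<^sup>2" by simp
  from order_tendstoD(2)[OF assms(1) this] obtain N where "e N < \<epsilon>\<^sup>2"
    by (auto simp: eventually_sequentially)
  then have "(dist (y n) (y N))\<^sup>2 < \<epsilon>\<^sup>2" if "n \<ge> N" for n
    using assms(2)[OF that] by (simp add: dist_commute)
  then show "\<exists>N. \<forall>n\<ge>N. dist (y n) (y N) < \<epsilon>"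
    using \<open>0 < \<epsilon>\<close> by (meson less_imp_le power2_less_imp_less)
qed

text \<open>Apollonius' identity. In a convex set the midpoint cannot beat the least distance to
  \<open>a\<close>, so two near-minimisers must be close together.\<close>

lemma parallelogram_midpoint:
  fixes y z :: "'a::real_inner"
  shows "(dist y z)\<^sup>2 = 2 * (dist a y)\<^sup>2 + 2 * (dist a z)\<^sup>2
    - 4 * (dist a ((1/2) *\<^sub>R y + (1/2) *\<^sub>R z))\<^sup>2"
  unfolding dist_norm power2_norm_eq_inner
  by (simp add: inner_diff inner_add inner_commute algebra_simps)

lemma nearest_point_exists:
  fixes D :: "'a::{real_inner, complete_space} set"
  assumes "closed D" "convex D" "D \<noteq> {}"
  shows "\<exists>y\<in>D. \<forall>z\<in>D. dist a y \<le> dist a z"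
proof -
  define d where "d = infdist a D"
  have d: "d \<le> dist a z" if "z \<in> D" for z
    unfolding d_def using that by (rule infdist_le)
  have d0: "0 \<le> d" by (simp add: d_def infdist_nonneg)
  have ex: "\<exists>y\<in>D. dist a y < d + inverse (real (Suc n))" for n
  proof (rule ccontr)
    assume "\<not> ?thesis"
    then have "d + inverse (real (Suc n)) \<le> d"
      unfolding d_def infdist_notempty[OF assms(3)]
      by (intro cINF_greatest) (use assms(3) in \<open>auto simp: not_less\<close>)
    then show False by simp
  qed
  obtain y where yD: "\<And>n. y n \<in> D" and y: "\<And>n. dist a (y n) < d + inverse (real (Suc n))"
    using ex by metis
  have lim: "(\<lambda>n. d + inverse (real (Suc n))) \<longlonglongrightarrow> d + 0"
    by (intro tendsto_intros LIMSEQ_inverse_real_of_nat)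
  have "Cauchy y"
  proof (rule Cauchy_dist_squared)
    have "(\<lambda>n. 4 * (d + inverse (real (Suc n)))\<^sup>2 - 4 * d\<^sup>2) \<longlonglongrightarrow> 4 * (d + 0)\<^sup>2 - 4 * d\<^sup>2"
      by (intro tendsto_intros lim)
    then show "(\<lambda>n. 4 * (d + inverse (real (Suc n)))\<^sup>2 - 4 * d\<^sup>2) \<longlonglongrightarrow> 0" by simp
  next
    fix n m :: nat assume "n \<le> m"
    let ?m = "(1/2) *\<^sub>R y n + (1/2) *\<^sub>R y m"
    have "?m \<in> D" using yD assms(2) by (intro convexD) auto
    then have 1: "d\<^sup>2 \<le> (dist a ?m)\<^sup>2" using d d0 by (intro power_mono) auto
    have 2: "(dist a (y n))\<^sup>2 \<le> (d + inverse (real (Suc n)))\<^sup>2"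
      using y[of n] by (intro power_mono) auto
    have "inverse (real (Suc m)) \<le> inverse (real (Suc n))" using \<open>n \<le> m\<close> by simp
    then have "dist a (y m) \<le> d + inverse (real (Suc n))" using y[of m] by linarith
    then have 3: "(dist a (y m))\<^sup>2 \<le> (d + inverse (real (Suc n)))\<^sup>2"
      by (intro power_mono) auto
    show "(dist (y n) (y m))\<^sup>2 \<le> 4 * (d + inverse (real (Suc n)))\<^sup>2 - 4 * d\<^sup>2"
      unfolding parallelogram_midpoint[of "y n" "y m" a] using 1 2 3 by linarith
  qed
  then obtain l where l: "y \<longlonglongrightarrow> l"
    using Cauchy_convergent_iff convergent_def by blast
  have "l \<in> D" using closed_sequentially[OF assms(1)] yD l by blast
  have "(\<lambda>n. dist a (y n)) \<longlonglongrightarrow> dist a l" by (intro tendsto_intros l)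
  then have "dist a l \<le> d + 0"
    by (rule LIMSEQ_le[OF _ lim]) (use y in \<open>auto intro: less_imp_le\<close>)
  then show ?thesis using \<open>l \<in> D\<close> d by force
qed

text \<open>The two obtuse-angle conditions add up to a nonnegative inner product of
  \<open>p - q\<close> with \<open>(a - p) - (b - q)\<close>, and these two vectors sum to
  \<open>a - b\<close>.\<close>

lemma nearest_point_nonexpansive:
  fixes D :: "'a::real_inner set"
  assumes "closed D" "convex D"
    and "p \<in> D" "\<forall>z\<in>D. dist a p \<le> dist a z"
    and "q \<in> D" "\<forall>z\<in>D. dist b q \<le> dist b z"
  shows "dist p q \<le> dist a b"
proof -
  have "inner (a - p) (q - p) \<le> 0" "inner (b - q) (p - q) \<le> 0"
    using assms by (auto intro: any_closest_point_dot)
  then show ?thesis unfolding dist_norm norm_le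
    using inner_ge_zero[of "(a - p) - (b - q)"]
    by (simp add: inner_add inner_diff inner_commute)
qed

text \<open>A form of weak compactness: the points of least norm of the finite intersections form a
  Cauchy net, by the parallelogram law.\<close>

lemma closed_convex_finite_intersection_property:
  fixes \<F> :: "'a::{real_inner, complete_space} set set"
  assumes cl: "\<And>C. C \<in> \<F> \<Longrightarrow> closed C" and cv: "\<And>C. C \<in> \<F> \<Longrightarrow> convex C"
    and C0: "C0 \<in> \<F>" "bounded C0"
    and fip: "\<And>J. finite J \<Longrightarrow> J \<subseteq> \<F> \<Longrightarrow> \<Inter>J \<noteq> {}"
  shows "\<Inter>\<F> \<noteq> {}"
proof -
  \<comment> \<open>The net is indexed by finite subfamilies ordered by inclusion; containing
    \<open>C0\<close> keeps the least norms bounded.\<close>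
  define P where "P = {J. finite J \<and> J \<subseteq> \<F> \<and> C0 \<in> J}"
  have "\<exists>y\<in>\<Inter>J. \<forall>z\<in>\<Inter>J. dist 0 y \<le> dist 0 z" if "J \<in> P" for J
    using that cl cv fip unfolding P_def
    by (intro nearest_point_exists closed_Inter convex_Inter) auto
  then obtain m where m: "\<And>J. J \<in> P \<Longrightarrow> m J \<in> \<Inter>J"
    and mle: "\<And>J z. J \<in> P \<Longrightarrow> z \<in> \<Inter>J \<Longrightarrow> dist 0 (m J) \<le> dist 0 z"
    by metis
  define D where "D J = (dist 0 (m J))\<^sup>2" for J
  have Dmono: "D J \<le> D J'" if "J \<in> P" "J' \<in> P" "J \<subseteq> J'" for J J'
    unfolding D_def using mle[OF that(1), of "m J'"] m[OF that(2)] that(3)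
    by (intro power_mono) auto
  have key: "(dist (m J) (m J'))\<^sup>2 \<le> 2 * (D J' - D J)" if J: "J \<in> P" "J' \<in> P" "J \<subseteq> J'" for J J'
  proof -
    let ?m = "(1/2) *\<^sub>R m J + (1/2) *\<^sub>R m J'"
    have "convex (\<Inter>J)" using J(1) cv unfolding P_def by (intro convex_Inter) auto
    moreover have "m J \<in> \<Inter>J" "m J' \<in> \<Inter>J" using m[OF J(1)] m[OF J(2)] J(3) by auto
    ultimately have "?m \<in> \<Inter>J" by (intro convexD) auto
    then have "D J \<le> (dist 0 ?m)\<^sup>2"
      unfolding D_def using mle[OF J(1)] by (intro power_mono) auto
    moreover have "(dist (m J) (m J'))\<^sup>2 = 2 * D J + 2 * D J' - 4 * (dist 0 ?m)\<^sup>2"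
      unfolding D_def by (rule parallelogram_midpoint)
    ultimately show ?thesis by argo
  qed
  obtain r where r: "\<And>y. y \<in> C0 \<Longrightarrow> norm y \<le> r" using C0(2) unfolding bounded_iff by auto
  have "D J \<le> r\<^sup>2" if "J \<in> P" for J
    unfolding D_def using m[OF that] that r by (intro power_mono) (auto simp: P_def)
  then have bdd: "bdd_above (D ` P)" by (intro bdd_aboveI) auto
  define S where "S = Sup (D ` P)"
  have DS: "D J \<le> S" if "J \<in> P" for J
    unfolding S_def using that bdd by (intro cSup_upper) auto
  have "{C0} \<in> P" using C0 by (simp add: P_def)
  have "\<exists>J\<in>P. S - inverse (real (Suc n)) < D J" for n
  proof -
    have "S - inverse (real (Suc n)) < Sup (D ` P)" by (simp add: S_def)
    from less_cSupD[OF _ this] show ?thesis using \<open>{C0} \<in> P\<close> by blast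
  qed
  then obtain J where JP: "\<And>n. J n \<in> P" and J: "\<And>n. S - inverse (real (Suc n)) < D (J n)"
    by metis
  \<comment> \<open>Unions turn a sequence that nearly attains the supremum into an increasing
    one.\<close>
  define E where "E n = (\<Union>k\<le>n. J k)" for n
  have EP: "E n \<in> P" for n using JP unfolding P_def E_def by fastforce
  have ES: "S - D (E n) \<le> inverse (real (Suc n))" for n
    using J[of n] Dmono[OF JP[of n] EP[of n]] unfolding E_def by fastforce
  have lim: "(\<lambda>n. 2 * inverse (real (Suc n))) \<longlonglongrightarrow> 0"
    using tendsto_mult_right_zero[OF LIMSEQ_inverse_real_of_nat] by simp
  have near: "(dist (m (E n)) (m J'))\<^sup>2 \<le> 2 * inverse (real (Suc n))" if "J' \<in> P" "E n \<subseteq> J'" for n J'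
    using key[OF EP that] DS[OF that(1)] ES[of n] by argo
  have "E n \<subseteq> E k" if "n \<le> k" for n k unfolding E_def using that by (intro UN_mono) auto
  then have "Cauchy (\<lambda>n. m (E n))"
    by (intro Cauchy_dist_squared[OF lim] near EP)
  then obtain l where l: "(\<lambda>n. m (E n)) \<longlonglongrightarrow> l"
    using Cauchy_convergent_iff convergent_def by blast
  have "l \<in> C" if C: "C \<in> \<F>" for C
  proof -
    \<comment> \<open>Adding \<open>C\<close> to \<open>E n\<close> moves the minimiser by a
      vanishing amount, so \<open>l\<close> is also a limit of points of \<open>C\<close>.\<close>
    have CP: "insert C (E n) \<in> P" for n using EP[of n] C unfolding P_def by auto
    let ?z = "\<lambda>n. m (insert C (E n))"
    have sq: "(\<lambda>n. (dist (m (E n)) (?z n))\<^sup>2) \<longlonglongrightarrow> 0"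
      using near[OF CP] by (intro tendsto_sandwich[OF _ _ tendsto_const lim] always_eventually allI) auto
    have "(\<lambda>n. sqrt ((dist (m (E n)) (?z n))\<^sup>2)) \<longlonglongrightarrow> sqrt 0"
      by (intro tendsto_intros sq)
    then have "(\<lambda>n. dist (m (E n)) (?z n)) \<longlonglongrightarrow> 0" by simp
    then have "(\<lambda>n. m (E n) - ?z n) \<longlonglongrightarrow> 0"
      unfolding dist_norm by (rule tendsto_norm_zero_cancel)
    from tendsto_diff[OF l this] have "?z \<longlonglongrightarrow> l" by simp
    moreover have "?z n \<in> C" for n using m[OF CP] by auto
    ultimately show ?thesis using closed_sequentially[OF cl[OF C], of ?z l] by blast
  qed
  then show ?thesis by blast
qed

section \<open>Extension to one more point\<close>

text \<open>Averages of the constraints \<open>\<parallel>y - b\<parallel> \<le> \<parallel>x - a\<parallel>\<close> are encoded by points of the convex hull of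
  all \<open>(a, b, \<parallel>b\<parallel>\<^sup>2 - \<parallel>a\<parallel>\<^sup>2)\<close>, on which the difference of squares
  \<open>\<parallel>y - b\<parallel>\<^sup>2 - \<parallel>x - a\<parallel>\<^sup>2\<close> is an affine function.\<close>

definition lift_pair :: "'a::real_inner \<times> 'b::real_inner \<Rightarrow> 'a \<times> 'b \<times> real" where
  "lift_pair g = (fst g, snd g, (norm (snd g))\<^sup>2 - (norm (fst g))\<^sup>2)"

definition excess :: "'a::real_inner \<Rightarrow> 'b::real_inner \<Rightarrow> 'a \<times> 'b \<times> real \<Rightarrow> real" where
  "excess x y p = inner y y - inner x x + 2 * inner x (fst p) - 2 * inner y (fst (snd p)) + snd (snd p)"

lemma excess_lift_pair:
  "excess x y (lift_pair g) = (norm (y - snd g))\<^sup>2 - (norm (x - fst g))\<^sup>2"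
  unfolding excess_def lift_pair_def power2_norm_eq_inner
  by (simp add: inner_diff inner_commute algebra_simps)

lemma excess_eq:
  "excess x y p = (norm (y - fst (snd p)))\<^sup>2 - (norm (x - fst p))\<^sup>2
    + (snd (snd p) - (norm (fst (snd p)))\<^sup>2 + (norm (fst p))\<^sup>2)"
  unfolding excess_def power2_norm_eq_inner
  by (simp add: inner_diff inner_commute algebra_simps)

lemma excess_affine:
  assumes "s + t = 1"
  shows "excess x y (s *\<^sub>R p + t *\<^sub>R q) = s * excess x y p + t * excess x y q"
proof -
  have s: "s = 1 - t" using assms by simp
  show ?thesis unfolding excess_def s
    by (simp add: inner_add algebra_simps)
qed

text \<open>The form \<open>B\<close> is affine in each argument and equals
  \<open>|b - b'|^2 - |a - a'|^2\<close> at two lifted pairs, hence is nonpositive there. The sign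
  passes to the hull one argument at a time, and the diagonal gives the claim.\<close>

lemma lift_pair_hull_le:
  assumes G: "\<And>g g'. g \<in> F \<Longrightarrow> g' \<in> F \<Longrightarrow> norm (snd g - snd g') \<le> norm (fst g - fst g')"
    and p: "p \<in> convex hull (lift_pair ` F)"
  shows "snd (snd p) \<le> (norm (fst (snd p)))\<^sup>2 - (norm (fst p))\<^sup>2"
proof -
  define B where "B p p' = snd (snd p) + snd (snd p') - 2 * inner (fst (snd p)) (fst (snd p'))
    + 2 * inner (fst p) (fst p')" for p p' :: "'a \<times> 'b \<times> real"
  have Bsym: "B p p' = B p' p" for p p' by (simp add: B_def inner_commute)
  have Bcv: "convex {p'. B p p' \<le> 0}" for p
  proof (rule convexI)
    fix y z and s t :: real
    assume *: "y \<in> {p'. B p p' \<le> 0}" "z \<in> {p'. B p p' \<le> 0}" "0 \<le> s" "0 \<le> t" "s + t = 1"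
    have s: "s = 1 - t" using *(5) by simp
    have "B p (s *\<^sub>R y + t *\<^sub>R z) = s * B p y + t * B p z"
      unfolding B_def s by (simp add: inner_add algebra_simps)
    also have "\<dots> \<le> 0" using * by (simp add: add_nonpos_nonpos mult_nonneg_nonpos)
    finally show "s *\<^sub>R y + t *\<^sub>R z \<in> {p'. B p p' \<le> 0}" by simp
  qed
  have gen: "B (lift_pair g) (lift_pair g') \<le> 0" if "g \<in> F" "g' \<in> F" for g g'
  proof -
    have "(norm (snd g - snd g'))\<^sup>2 \<le> (norm (fst g - fst g'))\<^sup>2"
      using G[OF that] by (intro power_mono) auto
    then show ?thesis unfolding B_def lift_pair_def power2_norm_eq_inner
      by (simp add: inner_diff inner_commute)
  qed
  have "convex hull (lift_pair ` F) \<subseteq> {p'. B (lift_pair g) p' \<le> 0}" if "g \<in> F" for g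
    by (intro hull_minimal Bcv image_subsetI CollectI gen that)
  then have "lift_pair ` F \<subseteq> {p'. B p p' \<le> 0}"
    using p Bsym by fastforce
  then have "convex hull (lift_pair ` F) \<subseteq> {p'. B p p' \<le> 0}"
    by (intro hull_minimal Bcv)
  then have "B p p \<le> 0" using p by auto
  then show ?thesis unfolding B_def power2_norm_eq_inner by simp
qed

text \<open>A minimax argument.  If \<open>p\<close> maximises, over the convex hull, the least excess over the
  admissible set \<open>D\<close>, then the nearest point of \<open>D\<close> to the \<open>'b\<close>-component of \<open>p\<close> works: all its
  excesses are at most the maximum, and the maximum is nonpositive because for every \<open>(a, b, q)\<close> in
  the hull the point \<open>v x - v a + b\<close> of \<open>D\<close> has nonpositive excess.\<close>

lemma one_point_extension_finite:
  fixes v :: "'a::real_inner \<Rightarrow> 'b::{real_inner, complete_space}"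
  assumes v: "affine_map v" "1-lipschitz_on UNIV v"
    and K: "closed K" "convex K"
    and F: "finite F" "F \<noteq> {}" "\<And>g. g \<in> F \<Longrightarrow> v (fst g) - snd g \<in> K"
    and G: "\<And>g g'. g \<in> F \<Longrightarrow> g' \<in> F \<Longrightarrow> norm (snd g - snd g') \<le> norm (fst g - fst g')"
  shows "\<exists>y. v x - y \<in> K \<and> (\<forall>g\<in>F. norm (y - snd g) \<le> norm (x - fst g))"
proof -
  define H where "H = convex hull (lift_pair ` F)"
  define D where "D = {y. v x - y \<in> K}"
  have "closed D"
  proof -
    have "D = (\<lambda>y. v x - y) -` K" by (auto simp: D_def)
    then show ?thesis using K(1) by (simp add: closed_vimage continuous_on_diff)
  qed
  have "convex D"
  proof (rule convexI)
    fix y z and s t :: real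
    assume *: "y \<in> D" "z \<in> D" "0 \<le> s" "0 \<le> t" "s + t = 1"
    have s: "s = 1 - t" using *(5) by simp
    have "s *\<^sub>R (v x - y) + t *\<^sub>R (v x - z) \<in> K"
      using * K(2) by (intro convexD) (auto simp: D_def)
    also have "s *\<^sub>R (v x - y) + t *\<^sub>R (v x - z) = v x - (s *\<^sub>R y + t *\<^sub>R z)"
      unfolding s by (simp add: algebra_simps)
    finally show "s *\<^sub>R y + t *\<^sub>R z \<in> D" by (simp add: D_def)
  qed
  \<comment> \<open>Since \<open>v\<close> is affine, the difference of \<open>v (fst p)\<close> and
    \<open>fst (snd p)\<close> is affine in \<open>p\<close>, so membership in \<open>K\<close>
    passes from the generators to the hull.\<close>
  have memD: "v x - v (fst p) + fst (snd p) \<in> D" if "p \<in> H" for p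
  proof -
    have "convex {p :: 'a \<times> 'b \<times> real. v (fst p) - fst (snd p) \<in> K}"
    proof (rule convexI)
      fix y z :: "'a \<times> 'b \<times> real" and s t :: real
      assume *: "y \<in> {p. v (fst p) - fst (snd p) \<in> K}" "z \<in> {p. v (fst p) - fst (snd p) \<in> K}"
        "0 \<le> s" "0 \<le> t" "s + t = 1"
      have "s *\<^sub>R (v (fst y) - fst (snd y)) + t *\<^sub>R (v (fst z) - fst (snd z)) \<in> K"
        using * K(2) by (intro convexD) auto
      then show "s *\<^sub>R y + t *\<^sub>R z \<in> {p. v (fst p) - fst (snd p) \<in> K}"
        using affine_mapD[OF v(1) *(5)] by (simp add: algebra_simps)
    qed
    then have "H \<subseteq> {p. v (fst p) - fst (snd p) \<in> K}"
      unfolding H_def using F(3) by (intro hull_minimal) (auto simp: lift_pair_def)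
    then show ?thesis using that by (auto simp: D_def algebra_simps)
  qed
  have "compact H" unfolding H_def using F(1) by (intro finite_imp_compact_convex_hull) auto
  have "convex H" by (simp add: H_def)
  have FH: "lift_pair g \<in> H" if "g \<in> F" for g
    unfolding H_def using that by (intro hull_inc) auto
  then have "H \<noteq> {}" using F(2) by auto
  then have "D \<noteq> {}" using memD by blast
  have "\<exists>y\<in>D. \<forall>z\<in>D. dist b y \<le> dist b z" for b
    by (rule nearest_point_exists) fact+
  then obtain P where PD: "\<And>b. P b \<in> D" and Ple: "\<And>b z. z \<in> D \<Longrightarrow> dist b (P b) \<le> dist b z"
    by metis
  have "1-lipschitz_on UNIV P"
    unfolding lipschitz_on_def
    using nearest_point_nonexpansive[OF \<open>closed D\<close> \<open>convex D\<close>] PD Ple by auto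
  then have Pcont: "continuous_on UNIV P" by (rule lipschitz_on_continuous_on)
  \<comment> \<open>By \<open>excess_eq\<close>, \<open>y\<close> enters the excess only through its
    distance to the \<open>'b\<close>-component of \<open>p\<close>, so \<open>h p\<close> is the
    least excess over \<open>D\<close>.\<close>
  define h where "h p = excess x (P (fst (snd p))) p" for p
  have hle: "h p \<le> excess x y p" if "y \<in> D" for y p
  proof -
    have "dist (fst (snd p)) (P (fst (snd p))) \<le> dist (fst (snd p)) y" using Ple[OF that] .
    then have "(norm (P (fst (snd p)) - fst (snd p)))\<^sup>2 \<le> (norm (y - fst (snd p)))\<^sup>2"
      by (intro power_mono) (auto simp: dist_norm norm_minus_commute)
    then show ?thesis unfolding h_def excess_eq by simp
  qed
  have "continuous_on H h"
    unfolding h_def excess_def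
    by (intro continuous_intros continuous_on_compose2[OF Pcont]) auto
  then obtain p where p: "p \<in> H" and pmax: "\<And>q. q \<in> H \<Longrightarrow> h q \<le> h p"
    using continuous_attains_sup[OF \<open>compact H\<close> \<open>H \<noteq> {}\<close>] by blast
  have "h p \<le> 0"
  proof -
    let ?y = "v x - v (fst p) + fst (snd p)"
    have "norm (?y - fst (snd p)) \<le> norm (x - fst p)"
      using v(2) unfolding lipschitz_on_1_iff by simp
    then have "(norm (?y - fst (snd p)))\<^sup>2 \<le> (norm (x - fst p))\<^sup>2" by (intro power_mono) auto
    moreover have "snd (snd p) \<le> (norm (fst (snd p)))\<^sup>2 - (norm (fst p))\<^sup>2"
      using lift_pair_hull_le[OF G] p unfolding H_def by blast
    ultimately have "excess x ?y p \<le> 0" unfolding excess_eq by linarith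
    then show ?thesis using hle[OF memD[OF p], of p] by linarith
  qed
  have "norm (P (fst (snd p)) - snd g) \<le> norm (x - fst g)" if "g \<in> F" for g
  proof -
    \<comment> \<open>First variation at the maximiser: moving from \<open>p\<close> towards a
      generator cannot raise \<open>h\<close>, and the share of \<open>p\<close> is at least
      \<open>(1 - t) * h p\<close>. This bounds the generator's excess at the moved minimiser, and
      continuity of \<open>P\<close> lets \<open>t\<close> tend to 0.\<close>
    define q where "q t = (1 - t) *\<^sub>R p + t *\<^sub>R lift_pair g" for t :: real
    define f where "f t = excess x (P (fst (snd (q t)))) (lift_pair g)" for t
    have le: "f t \<le> h p" if t: "0 < t" "t < 1" for t
    proof -
      have "q t \<in> H" unfolding q_def
        using \<open>convex H\<close> p FH[OF \<open>g \<in> F\<close>] t by (intro convexD) auto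
      then have "h (q t) \<le> h p" by (rule pmax)
      moreover have "h (q t) = (1 - t) * excess x (P (fst (snd (q t)))) p + t * f t"
      proof -
        have "h (q t) = excess x (P (fst (snd (q t)))) ((1 - t) *\<^sub>R p + t *\<^sub>R lift_pair g)"
          unfolding h_def by (simp only: q_def)
        then show ?thesis by (simp add: excess_affine f_def)
      qed
      moreover have "(1 - t) * h p \<le> (1 - t) * excess x (P (fst (snd (q t)))) p"
        using hle[OF PD] t by (intro mult_left_mono) auto
      ultimately have "t * f t \<le> t * h p" by (simp add: algebra_simps)
      then show ?thesis using t by simp
    qed
    have "continuous_on UNIV f"
      unfolding f_def excess_def q_def
      by (intro continuous_intros continuous_on_compose2[OF Pcont]) auto
    then have "isCont f 0" by (simp add: continuous_on_eq_continuous_at)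
    then have "(f \<longlongrightarrow> f 0) (at_right 0)"
      unfolding isCont_def by (rule filterlim_at_split[THEN iffD1, THEN conjunct2])
    moreover have "eventually (\<lambda>t. f t \<le> h p) (at_right 0)"
      using le by (auto simp: eventually_at_right_field intro: exI[of _ 1])
    ultimately have "f 0 \<le> h p" by (rule tendsto_upperbound) simp
    then have "excess x (P (fst (snd p))) (lift_pair g) \<le> 0"
      using \<open>h p \<le> 0\<close> by (simp add: f_def q_def)
    then have "(norm (P (fst (snd p)) - snd g))\<^sup>2 \<le> (norm (x - fst g))\<^sup>2"
      by (simp add: excess_lift_pair)
    then show ?thesis by (rule power2_le_imp_le) simp
  qed
  then show ?thesis using PD[of "fst (snd p)"] unfolding D_def by blast
qed

text \<open>Each constraint set is a ball cut with the admissible set, so it is closed, convex and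
  bounded; finite subfamilies are handled by the previous lemma.\<close>

lemma one_point_extension:
  fixes v :: "'a::real_inner \<Rightarrow> 'b::{real_inner, complete_space}"
  assumes v: "affine_map v" "1-lipschitz_on UNIV v"
    and K: "closed K" "convex K"
    and F: "F \<noteq> {}" "\<And>g. g \<in> F \<Longrightarrow> v (fst g) - snd g \<in> K"
    and G: "\<And>g g'. g \<in> F \<Longrightarrow> g' \<in> F \<Longrightarrow> norm (snd g - snd g') \<le> norm (fst g - fst g')"
  shows "\<exists>y. v x - y \<in> K \<and> (\<forall>g\<in>F. norm (y - snd g) \<le> norm (x - fst g))"
proof -
  define C where "C g = {y. v x - y \<in> K} \<inter> cball (snd g) (norm (x - fst g))" for g
  have K': "{y. v x - y \<in> K} = (\<lambda>z. v x - z) ` K"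
    by (auto simp: image_iff) (metis add_diff_cancel_left' diff_add_cancel)
  have "\<Inter>(C ` F) \<noteq> {}"
  proof (rule closed_convex_finite_intersection_property)
    have "{y. v x - y \<in> K} = (\<lambda>y. v x - y) -` K" by auto
    then have "closed {y. v x - y \<in> K}"
      using K(1) by (simp add: closed_vimage continuous_on_diff)
    then show "closed A" if "A \<in> C ` F" for A using that by (auto simp: C_def)
    have "convex {y. v x - y \<in> K}"
      unfolding K' using convex_affinity[OF K(2), of "v x" "-1"] by (simp add: image_def)
    then show "convex A" if "A \<in> C ` F" for A
      using that by (auto simp: C_def intro: convex_Int)
    obtain g where "g \<in> F" using F(1) by blast
    then show "C (SOME g. g \<in> F) \<in> C ` F" by (auto intro: someI)
    show "bounded (C (SOME g. g \<in> F))" by (auto simp: C_def intro: bounded_subset[OF bounded_cball])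
  next
    fix J assume J: "finite J" "J \<subseteq> C ` F"
    then obtain F' where F': "F' \<subseteq> F" "finite F'" "J = C ` F'"
      by (meson finite_subset_image)
    show "\<Inter>J \<noteq> {}"
    proof (cases "F' = {}")
      case False
      have "\<exists>y. v x - y \<in> K \<and> (\<forall>g\<in>F'. norm (y - snd g) \<le> norm (x - fst g))"
        by (rule one_point_extension_finite[OF v K F'(2) False]) (use F'(1) F(2) G in blast)+
      then obtain y where "v x - y \<in> K" "\<And>g. g \<in> F' \<Longrightarrow> norm (y - snd g) \<le> norm (x - fst g)"
        by blast
      then have "y \<in> \<Inter>J" unfolding F'(3) C_def by (simp add: dist_norm norm_minus_commute)
      then show ?thesis by blast
    qed (simp add: F')
  qed
  then obtain y where "\<And>g. g \<in> F \<Longrightarrow> y \<in> C g" by auto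
  then show ?thesis using F(1)
    by (intro exI[of _ y]) (auto simp: C_def dist_norm norm_minus_commute)
qed

section \<open>Extension to the whole space\<close>

lemma affine_lipschitz_imp_hull_extension:
  fixes v :: "'a::real_inner \<Rightarrow> 'b::{real_inner, complete_space}"
  assumes v: "affine_map v" "1-lipschitz_on UNIV v"
  shows "hull_extension_property v"
  unfolding hull_extension_property_def
proof (intro allI impI, elim conjE)
  fix A and u :: "'a \<Rightarrow> 'b"
  assume "A \<noteq> {}" and u: "1-lipschitz_on A u"
  define K where "K = closed_convex_hull {v z - u z | z. z \<in> A}"
  have K: "closed K" "convex K" by (auto simp: K_def closed_convex_hull_def)
  have uK: "v z - u z \<in> K" if "z \<in> A" for z
    unfolding K_def closed_convex_hull_def using that
    by (intro closure_subset[THEN subsetD] hull_inc) auto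
  \<comment> \<open>Partial extensions are ordered as graphs; the distance inequality already makes
    such a set single-valued.\<close>
  define \<G> where "\<G> = {G. (\<lambda>z. (z, u z)) ` A \<subseteq> G \<and> (\<forall>g\<in>G. v (fst g) - snd g \<in> K) \<and>
    (\<forall>g\<in>G. \<forall>g'\<in>G. norm (snd g - snd g') \<le> norm (fst g - fst g'))}"
  have "\<exists>M\<in>\<G>. \<forall>G\<in>\<G>. M \<subseteq> G \<longrightarrow> G = M"
  proof (rule subset_Zorn_nonempty)
    have "(\<lambda>z. (z, u z)) ` A \<in> \<G>"
      using u uK unfolding \<G>_def lipschitz_on_1_iff by auto
    then show "\<G> \<noteq> {}" by blast
  next
    fix \<C> assume "\<C> \<noteq> {}" and ch: "subset.chain \<G> \<C>"
    have sub: "\<C> \<subseteq> \<G>" and lin: "G \<subseteq> G' \<or> G' \<subseteq> G" if "G \<in> \<C>" "G' \<in> \<C>" for G G'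
      using ch that unfolding subset.chain_def by auto
    show "\<Union>\<C> \<in> \<G>"
      unfolding \<G>_def
    proof (intro CollectI conjI ballI)
      show "(\<lambda>z. (z, u z)) ` A \<subseteq> \<Union>\<C>"
        using \<open>\<C> \<noteq> {}\<close> sub unfolding \<G>_def by blast
      show "v (fst g) - snd g \<in> K" if "g \<in> \<Union>\<C>" for g
        using that sub unfolding \<G>_def by blast
      fix g g' assume "g \<in> \<Union>\<C>" "g' \<in> \<Union>\<C>"
      then obtain G G' where GG: "g \<in> G" "g' \<in> G'" "G \<in> \<C>" "G' \<in> \<C>" by blast
      have "\<exists>G\<in>\<C>. g \<in> G \<and> g' \<in> G"
        using lin[OF GG(3,4)] GG by blast
      then obtain G'' where "G'' \<in> \<C>" "g \<in> G''" "g' \<in> G''" by blast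
      moreover from this have "G'' \<in> \<G>" using sub by blast
      ultimately show "norm (snd g - snd g') \<le> norm (fst g - fst g')" unfolding \<G>_def by blast
    qed
  qed
  then obtain M where M: "M \<in> \<G>" and Mmax: "\<And>G. G \<in> \<G> \<Longrightarrow> M \<subseteq> G \<Longrightarrow> G = M" by blast
  have MA: "(z, u z) \<in> M" if "z \<in> A" for z using M that unfolding \<G>_def by blast
  have MK: "v (fst g) - snd g \<in> K" if "g \<in> M" for g using M that unfolding \<G>_def by blast
  have Mlip: "norm (snd g - snd g') \<le> norm (fst g - fst g')" if "g \<in> M" "g' \<in> M" for g g'
    using M that unfolding \<G>_def by blast
  have "M \<noteq> {}" using MA \<open>A \<noteq> {}\<close> by blast
  have "\<exists>y. (x, y) \<in> M" for x
  proof -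
    obtain y where y: "v x - y \<in> K" "\<And>g. g \<in> M \<Longrightarrow> norm (y - snd g) \<le> norm (x - fst g)"
      using one_point_extension[OF v K \<open>M \<noteq> {}\<close> MK Mlip] by blast
    have "insert (x, y) M \<in> \<G>"
      unfolding \<G>_def using y MA MK Mlip
      by (auto simp: norm_minus_commute)
    then have "insert (x, y) M = M" by (intro Mmax) auto
    then show ?thesis by blast
  qed
  then obtain u' where u': "\<And>x. (x, u' x) \<in> M" by metis
  have "u' z = u z" if "z \<in> A" for z
    using Mlip[OF u'[of z] MA[OF that]] by simp
  moreover have "1-lipschitz_on UNIV u'"
    unfolding lipschitz_on_1_iff using Mlip[OF u' u'] by simp
  moreover have "v x - u' x \<in> K" for x using MK[OF u'] by simp
  ultimately show "\<exists>u'. is_lipschitz_extension A u u' \<and>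
      (\<forall>x. v x - u' x \<in> closed_convex_hull {v z - u z | z. z \<in> A})"
    unfolding is_lipschitz_extension_def K_def by blast
qed

lemma hull_extension_imp_uniform_extension:
  fixes v :: "'a::real_normed_vector \<Rightarrow> 'b::real_normed_vector"
  assumes v: "hull_extension_property v"
  shows "uniform_extension_property v"
  unfolding uniform_extension_property_def
proof (intro allI impI, elim conjE)
  fix \<delta> :: real and A and u :: "'a \<Rightarrow> 'b"
  assume "0 < \<delta>" and u: "1-lipschitz_on A u" and le: "\<forall>x\<in>A. norm (v x - u x) \<le> \<delta>"
  show "\<exists>u'. is_lipschitz_extension A u u' \<and> (\<forall>x. norm (v x - u' x) \<le> \<delta>)"
  proof (cases "A = {}")
    case True
    \<comment> \<open>The hull property says nothing about the empty domain. Prescribing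
      \<open>v\<close> at the single point 0 makes the hull \<open>{0}\<close>, which forces the
      extension to be \<open>v\<close>, so \<open>v\<close> is itself 1-Lipschitz.\<close>
    have "1-lipschitz_on {0} (\<lambda>_::'a. v 0)" by (simp add: lipschitz_on_1_iff)
    then obtain w where w: "1-lipschitz_on UNIV w"
      "\<And>x. v x - w x \<in> closed_convex_hull {v z - v 0 | z. z \<in> {0}}"
      using v unfolding hull_extension_property_def is_lipschitz_extension_def by blast
    have "{v z - v 0 | z. z \<in> {0::'a}} = {0}" by auto
    then have "w = v" using w(2) by (auto simp: closed_convex_hull_def)
    then show ?thesis using True w(1) \<open>0 < \<delta>\<close>
      by (intro exI[of _ v]) (auto simp: is_lipschitz_extension_def)
  next
    case False
    then obtain u' where u': "is_lipschitz_extension A u u'"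
      "\<And>x. v x - u' x \<in> closed_convex_hull {v z - u z | z. z \<in> A}"
      using v u unfolding hull_extension_property_def by blast
    have "closed_convex_hull {v z - u z | z. z \<in> A} \<subseteq> cball 0 \<delta>"
      unfolding closed_convex_hull_def using le
      by (intro closure_minimal hull_minimal) auto
    from subsetD[OF this u'(2)] have "norm (v x - u' x) \<le> \<delta>" for x by simp
    then show ?thesis using u'(1) by blast
  qed
qed

section \<open>Necessity of affineness\<close>

text \<open>On the empty domain the hypothesis of the property is vacuous, so \<open>v\<close> is
  within any positive distance of a 1-Lipschitz map.\<close>

lemma uniform_extension_imp_lipschitz:
  fixes v :: "'a::real_normed_vector \<Rightarrow> 'b::real_normed_vector"
  assumes v: "uniform_extension_property v"
  shows "1-lipschitz_on UNIV v"
  unfolding lipschitz_on_1_iff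
proof (intro ballI, rule field_le_epsilon)
  fix x y and e :: real assume "0 < e"
  have "\<exists>w. is_lipschitz_extension {} v w \<and> (\<forall>x. norm (v x - w x) \<le> e/2)"
  proof -
    have "0 < e/2" using \<open>0 < e\<close> by simp
    moreover have "1-lipschitz_on {} v \<and> (\<forall>x\<in>{}. norm (v x - v x) \<le> e/2)"
      by (simp add: lipschitz_on_def)
    ultimately show ?thesis
      using v[unfolded uniform_extension_property_def, THEN spec, THEN mp, THEN spec, THEN spec, THEN mp]
      by blast
  qed
  then obtain w where w: "1-lipschitz_on UNIV w" "\<And>x. norm (v x - w x) \<le> e/2"
    unfolding is_lipschitz_extension_def by blast
  have "v x - v y = (v x - w x) + (w x - w y) - (v y - w y)" by simp
  then have "norm (v x - v y) \<le> norm (v x - w x) + norm (w x - w y) + norm (v y - w y)"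
    by (metis norm_triangle_ineq norm_triangle_ineq4 add_right_mono order_trans)
  moreover have "norm (w x - w y) \<le> norm (x - y)"
    using w(1) by (simp add: lipschitz_on_1_iff)
  ultimately show "norm (v x - v y) \<le> norm (x - y) + e"
    using w(2)[of x] w(2)[of y] by linarith
qed

section \<open>Orthogonal corrections and rigidity of segments\<close>

lemma exists_orthogonal_unit:
  fixes d :: "'b::real_inner"
  assumes "dim_at_least_two TYPE('b)"
  shows "\<exists>n. norm n = 1 \<and> inner n d = 0"
proof -
  obtain B :: "'b set" where B: "independent B" "card B = 2"
    using assms unfolding dim_at_least_two_def by blast
  have "\<not> B \<subseteq> span {d}"
  proof
    assume "B \<subseteq> span {d}"
    then have "card B \<le> card {d}"
      by (intro independent_span_bound[THEN conjunct2]) (use B in auto)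
    then show False using B by simp
  qed
  then obtain b where b: "b \<notin> span {d}" by blast
  \<comment> \<open>One Gram-Schmidt step. For \<open>d = 0\<close> the quotient is 0 by convention
    and \<open>m\<close> is just \<open>b\<close>.\<close>
  define m where "m = b - (inner b d / inner d d) *\<^sub>R d"
  have "m \<noteq> 0"
  proof
    assume "m = 0"
    then have "b = (inner b d / inner d d) *\<^sub>R d" by (simp add: m_def)
    then show False using b by (metis insertI1 span_base span_scale)
  qed
  moreover have "inner m d = 0" by (simp add: m_def inner_diff)
  ultimately show ?thesis
    by (intro exI[of _ "m /\<^sub>R norm m"]) auto
qed

lemma exists_orthogonal_shift_of_norm:
  fixes n w :: "'b::real_inner"
  assumes "norm n = 1" and "norm w \<le> L"
  shows "\<exists>s. norm (w + s *\<^sub>R n) = L"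
proof -
  have L0: "0 \<le> L" using assms(2) norm_ge_zero order_trans by blast
  \<comment> \<open>The larger root of the quadratic equation \<open>|w + s n|^2 = L^2\<close>; its
    discriminant is nonnegative because \<open>norm w \<le> L\<close>.\<close>
  define s where "s = sqrt ((inner w n)\<^sup>2 + L\<^sup>2 - (norm w)\<^sup>2) - inner w n"
  have "(norm w)\<^sup>2 \<le> L\<^sup>2" using assms(2) by (intro power_mono) auto
  then have "0 \<le> (inner w n)\<^sup>2 + L\<^sup>2 - (norm w)\<^sup>2"
    using zero_le_power2[of "inner w n"] by linarith
  then have "(s + inner w n)\<^sup>2 = (inner w n)\<^sup>2 + L\<^sup>2 - (norm w)\<^sup>2" by (simp add: s_def)
  then have "s\<^sup>2 + 2 * s * inner w n + (norm w)\<^sup>2 = L\<^sup>2" by (simp add: power2_eq_square algebra_simps)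
  moreover have "inner n n = 1" using assms(1) by (simp add: dot_square_norm)
  then have "(norm (w + s *\<^sub>R n))\<^sup>2 = s\<^sup>2 + 2 * s * inner w n + (norm w)\<^sup>2"
    unfolding power2_norm_eq_inner
    by (simp add: inner_add inner_commute power2_eq_square algebra_simps)
  ultimately have "(norm (w + s *\<^sub>R n))\<^sup>2 = L\<^sup>2" by simp
  then show ?thesis using L0 by (intro exI[of _ s]) (simp add: power2_eq_iff_nonneg)
qed

text \<open>Strict convexity in the form of Stewart's identity: the two balls have radii adding up
  to the distance of their centres, so they touch in a single point.\<close>

lemma between_point_unique:
  fixes p q r :: "'b::real_inner"
  assumes t: "0 \<le> t" "t \<le> 1"
    and pq: "norm (p - q) = L" and rp: "norm (r - p) \<le> (1 - t) * L" and rq: "norm (r - q) \<le> t * L"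
  shows "r = t *\<^sub>R p + (1 - t) *\<^sub>R q"
proof -
  have "(norm (r - (t *\<^sub>R p + (1 - t) *\<^sub>R q)))\<^sup>2
      = t * (norm (r - p))\<^sup>2 + (1 - t) * (norm (r - q))\<^sup>2 - t * (1 - t) * (norm (p - q))\<^sup>2"
    unfolding power2_norm_eq_inner
    by (simp add: inner_diff inner_add inner_commute algebra_simps)
  also have "\<dots> \<le> t * ((1 - t) * L)\<^sup>2 + (1 - t) * (t * L)\<^sup>2 - t * (1 - t) * L\<^sup>2"
    unfolding pq using t rp rq by (intro diff_right_mono add_mono mult_left_mono power_mono) auto
  also have "\<dots> = 0" by (simp add: power2_eq_square algebra_simps)
  finally show ?thesis by simp
qed

text \<open>If \<open>v\<close> has defect \<open>d\<close> at a point of the segment from \<open>x\<close> to \<open>y\<close>, perturb \<open>v\<close> at the endpoints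
  by \<open>- (r / \<parallel>d\<parallel>) d\<close> plus fixed multiples of a vector orthogonal to \<open>d\<close>, chosen so that the
  distance of the endpoints is preserved.  The extension is then forced on the segment and deviates from
  \<open>v\<close> by \<open>r + \<parallel>d\<parallel>\<close>, whereas the deviation at the endpoints is only \<open>r + O(1/r)\<close>.\<close>

lemma uniform_extension_imp_affine_on_segment:
  fixes v :: "'a::real_normed_vector \<Rightarrow> 'b::real_inner"
  assumes dim: "dim_at_least_two TYPE('b)"
    and v: "uniform_extension_property v"
    and t: "0 \<le> t" "t \<le> 1"
  shows "v (t *\<^sub>R x + (1 - t) *\<^sub>R y) = t *\<^sub>R v x + (1 - t) *\<^sub>R v y"
proof (cases "x = y")
  case True
  then show ?thesis by (simp flip: scaleR_left_distrib)
next
  case False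
  define z where "z = t *\<^sub>R x + (1 - t) *\<^sub>R y"
  define d where "d = v z - (t *\<^sub>R v x + (1 - t) *\<^sub>R v y)"
  define L where "L = norm (x - y)"
  have "norm (v x - v y) \<le> L"
    using uniform_extension_imp_lipschitz[OF v] by (simp add: lipschitz_on_1_iff L_def)
  moreover obtain n where n: "norm n = 1" "inner n d = 0"
    using exists_orthogonal_unit[OF dim] by blast
  ultimately obtain s where s: "norm (v x - v y + s *\<^sub>R n) = L"
    using exists_orthogonal_shift_of_norm by blast
  have nn: "inner n n = 1" using n(1) by (simp add: dot_square_norm)
  have dn: "inner d n = 0" using n(2) by (simp add: inner_commute)
  have "d = 0"
  proof (rule ccontr)
    assume "d \<noteq> 0"
    \<comment> \<open>Chosen so that \<open>r * norm d\<close> is \<open>s\<^sup>2 + norm d\<close>,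
      which pushes \<open>(norm d + r)\<^sup>2\<close> above
      \<open>r\<^sup>2 + s\<^sup>2\<close>.\<close>
    define r where "r = s\<^sup>2 / norm d + 1"
    define c where "c = - (r / norm d) *\<^sub>R d"
    define \<delta> where "\<delta> = sqrt (r\<^sup>2 + s\<^sup>2)"
    \<comment> \<open>The coefficients of \<open>n\<close> differ by \<open>s\<close>, restoring the
      distance \<open>L\<close>, and their average with weights \<open>t\<close> and
      \<open>1 - t\<close> is 0, so only \<open>c\<close> survives at \<open>z\<close>.\<close>
    define u where "u = (\<lambda>w. if w = x then v x + (((1 - t) * s) *\<^sub>R n + c)
      else v y + ((- t * s) *\<^sub>R n + c))"
    have "0 < r" by (simp add: r_def add_nonneg_pos)
    then have "0 < \<delta>" by (simp add: \<delta>_def add_pos_nonneg)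
    have cc: "inner c c = r\<^sup>2"
      using \<open>d \<noteq> 0\<close> by (simp add: c_def power2_eq_square flip: dot_square_norm norm_eq_sqrt_inner)
        (simp add: power2_norm_eq_inner[symmetric] power2_eq_square)
    have cn: "inner c n = 0" "inner n c = 0" by (simp_all add: c_def n dn)
    have bound: "norm ((k * s) *\<^sub>R n + c) \<le> \<delta>" if "\<bar>k\<bar> \<le> 1" for k
    proof -
      have "k\<^sup>2 \<le> 1" using that by (simp add: abs_square_le_1)
      have "(norm ((k * s) *\<^sub>R n + c))\<^sup>2 = k\<^sup>2 * s\<^sup>2 + r\<^sup>2"
        unfolding power2_norm_eq_inner
        by (simp add: inner_add cn cc nn power2_eq_square)
      also have "\<dots> \<le> r\<^sup>2 + s\<^sup>2"
        using mult_right_mono[OF \<open>k\<^sup>2 \<le> 1\<close>, of "s\<^sup>2"] by simp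
      finally show ?thesis unfolding \<delta>_def by (rule real_le_rsqrt)
    qed
    have ux: "u x = v x + (((1 - t) * s) *\<^sub>R n + c)" and uy: "u y = v y + ((- t * s) *\<^sub>R n + c)"
      using False by (auto simp: u_def)
    have diff: "u x - u y = v x - v y + s *\<^sub>R n"
      unfolding ux uy by (simp add: algebra_simps)
    then have uL: "norm (u x - u y) = L" using s by simp
    then have "1-lipschitz_on {x, y} u"
      unfolding lipschitz_on_1_iff by (auto simp: L_def norm_minus_commute)
    moreover have "norm (v x - u x) \<le> \<delta>"
      using bound[of "1 - t"] t unfolding ux
      by (metis abs_of_nonneg add_diff_cancel_left' diff_ge_0_iff_ge diff_le_eq le_add_same_cancel1
          norm_minus_commute)
    moreover have "norm (v y - u y) \<le> \<delta>"
      using bound[of "- t"] t unfolding uy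
      by (metis abs_minus_cancel abs_of_nonneg add_diff_cancel_left' norm_minus_commute)
    ultimately obtain u' where u': "is_lipschitz_extension {x, y} u u'"
      "\<And>x. norm (v x - u' x) \<le> \<delta>"
      using v \<open>0 < \<delta>\<close> unfolding uniform_extension_property_def by (metis insertE singletonD)
    have lip: "norm (u' a - u' b) \<le> norm (a - b)" for a b
      using u'(1) unfolding is_lipschitz_extension_def lipschitz_on_1_iff by blast
    have eq: "u' x = u x" "u' y = u y" using u'(1) unfolding is_lipschitz_extension_def by auto
    have "z - x = (1 - t) *\<^sub>R (y - x)" "z - y = t *\<^sub>R (x - y)"
      unfolding z_def by (simp_all add: algebra_simps)
    then have "norm (z - x) = (1 - t) * L" "norm (z - y) = t * L"
      unfolding L_def using t by (simp_all add: norm_minus_commute)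
    then have "u' z = t *\<^sub>R u x + (1 - t) *\<^sub>R u y"
      using lip[of z x] lip[of z y] uL unfolding eq
      by (intro between_point_unique[OF t]) auto
    then have "v z - u' z = d - c"
      unfolding ux uy d_def by (simp add: algebra_simps)
    also have "\<dots> = (1 + r / norm d) *\<^sub>R d" by (simp add: c_def algebra_simps)
    finally have "norm (v z - u' z) = (1 + r / norm d) * norm d"
      using \<open>0 < r\<close> by (simp add: add_nonneg_nonneg)
    also have "\<dots> = norm d + r" using \<open>d \<noteq> 0\<close> by (simp add: field_simps)
    finally have "norm d + r \<le> \<delta>" using u'(2)[of z] by simp
    then have "(norm d + r)\<^sup>2 \<le> r\<^sup>2 + s\<^sup>2"
      unfolding \<delta>_def using \<open>0 < r\<close> by (intro sqrt_ge_absD) auto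
    then have "(norm d)\<^sup>2 + 2 * (r * norm d) \<le> s\<^sup>2" by (simp add: power2_sum algebra_simps)
    moreover have "r * norm d = s\<^sup>2 + norm d" using \<open>d \<noteq> 0\<close> by (simp add: r_def field_simps)
    moreover have "0 < norm d" using \<open>d \<noteq> 0\<close> by simp
    moreover have "0 \<le> (norm d)\<^sup>2" "0 \<le> s\<^sup>2" by simp_all
    ultimately show False by linarith
  qed
  then show ?thesis by (simp add: d_def z_def)
qed

section \<open>From segments to lines\<close>

lemma affine_on_segments_imp_affine_map:
  fixes v :: "'a::real_vector \<Rightarrow> 'b::real_vector"
  assumes seg: "\<And>x y t. 0 \<le> t \<Longrightarrow> t \<le> 1 \<Longrightarrow>
    v (t *\<^sub>R x + (1 - t) *\<^sub>R y) = t *\<^sub>R v x + (1 - t) *\<^sub>R v y"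
  shows "affine_map v"
proof -
  have gt: "v (t *\<^sub>R x + (1 - t) *\<^sub>R y) = t *\<^sub>R v x + (1 - t) *\<^sub>R v y" if "1 < t" for x y t
  proof -
    \<comment> \<open>For \<open>t > 1\<close> it is \<open>x\<close> that lies between
      \<open>?z\<close> and \<open>y\<close>, so the segment case is solved for \<open>v ?z\<close>;
      negative \<open>t\<close> follows by swapping \<open>x\<close> and \<open>y\<close>.\<close>
    let ?z = "t *\<^sub>R x + (1 - t) *\<^sub>R y"
    have "x = (1/t) *\<^sub>R ?z + (1 - 1/t) *\<^sub>R y"
      using that by (simp add: scaleR_right_distrib field_simps flip: scaleR_left_distrib)
    then have "v x = (1/t) *\<^sub>R v ?z + (1 - 1/t) *\<^sub>R v y"
      using seg[of "1/t" ?z y] that by simp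
    then have "t *\<^sub>R v x = t *\<^sub>R ((1/t) *\<^sub>R v ?z + (1 - 1/t) *\<^sub>R v y)" by simp
    also have "\<dots> = v ?z + (t - 1) *\<^sub>R v y"
      using that by (simp add: scaleR_right_distrib right_diff_distrib)
    finally show ?thesis by (simp add: algebra_simps)
  qed
  have "v (t *\<^sub>R x + (1 - t) *\<^sub>R y) = t *\<^sub>R v x + (1 - t) *\<^sub>R v y" for x y and t :: real
  proof -
    consider "t < 0" | "0 \<le> t" "t \<le> 1" | "1 < t" by linarith
    then show ?thesis
    proof cases
      case 1
      then show ?thesis using gt[of "1 - t" y x] by (simp add: add.commute)
    qed (use seg gt in auto)
  qed
  then show ?thesis unfolding affine_map_def by blast
qed

theorem theorem3p9:
  fixes v :: "'a::{real_inner, complete_space} \<Rightarrow> 'b::{real_inner, complete_space}"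
  assumes "dim_at_least_two TYPE('b)"
  shows "(hull_extension_property v \<longleftrightarrow> uniform_extension_property v) \<and>
         (uniform_extension_property v \<longleftrightarrow> affine_map v \<and> 1-lipschitz_on UNIV v)"
  using affine_lipschitz_imp_hull_extension[of v] hull_extension_imp_uniform_extension[of v]
    uniform_extension_imp_lipschitz[of v]
    affine_on_segments_imp_affine_map[of v, OF uniform_extension_imp_affine_on_segment[OF assms]]
  by blast

end
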